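(* Let $(M,J,g)$ be an almost complex manifold with Norden metric, $\tilde g(x,y)=g(Jx,y)$ its associated Norden metric, and $D$, $\tilde D$ the Levi-Civita connections of $g$, $\tilde g$ with curvature tensors $R^{D}$, $R^{\tilde D}$. Then any linear combination of the average tensor $B=\frac12(R^{D}+R^{\tilde D})$ and the curvature tensor $R^{D^{\diamond}}$ of the average connection $D^{\diamond}=\frac12(D+\tilde D)$ is an invariant tensor under the twin interchange.
   Context: An almost complex manifold with Norden metric $(M,J,g)$ is a $2n$-dimensional manifold with $J^2=-I$ and a pseudo-Riemannian metric $g$ with $g(Jx,Jy)=-g(x,y)$. The metric $\tilde g(x,y)=g(Jx,y)$ is again a Norden metric; the associated metric of $\tilde g$ is $-g$. The twin interchange is the interchange of $D$ and $\tilde D$ (and of the metrics $g$ and $\tilde g$). A tensor constructed from $(M,J,g)$ is invariant under the twin interchange if it equals the tensor obtained by the same construction from $(M,J,\tilde g)$. The curvature tensor of a connection $\nabla$ is the $(1,3)$-tensor $R^\nabla(x,y)z=\nabla_x\nabla_yz-\nabla_y\nabla_xz-\nabla_{[x,y]}z$. The average connection is $D^{\diamond}_xy=\frac12\{D_xy+\tilde D_xy\}$ and the average tensor is $B(x,y)z=\frac12\{R^{D}(x,y)z+R^{\tilde D}(x,y)z\}$. *)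

theory Defs
  imports "HOL-Analysis.Analysis" "HOL-Library.Function_Algebras"
begin

section \<open>Smooth manifolds\<close>

(* Only meant for open S. The directional derivatives in all directions v are
   again required to be of class C^k. *)
primrec Ck_on :: "nat \<Rightarrow> 'e::euclidean_space set \<Rightarrow> ('e \<Rightarrow> 'b::real_normed_vector) \<Rightarrow> bool" where
  "Ck_on 0 S f \<longleftrightarrow> continuous_on S f"
| "Ck_on (Suc k) S f \<longleftrightarrow> (\<forall>x\<in>S. f differentiable (at x)) \<and>
     (\<forall>v. Ck_on k S (\<lambda>x. frechet_derivative f (at x) v))"

definition smooth_on :: "'e::euclidean_space set \<Rightarrow> ('e \<Rightarrow> 'b::real_normed_vector) \<Rightarrow> bool" where
  "smooth_on S f \<longleftrightarrow> (\<forall>k. Ck_on k S f)"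

(* A chart is a pair (U, \<phi>) of a coordinate domain and a coordinate map, of which only the
   values on U matter. The manifold is the whole type 'a, modelled on 'e. *)
type_synonym ('a, 'e) atlas = "('a set \<times> ('a \<Rightarrow> 'e)) set"

definition chart :: "'a::topological_space set \<times> ('a \<Rightarrow> 'e::euclidean_space) \<Rightarrow> bool" where
  "chart = (\<lambda>(U, \<phi>). open U \<and> open (\<phi> ` U) \<and> (\<exists>\<psi>. homeomorphism U (\<phi> ` U) \<phi> \<psi>))"

definition smooth_manifold ::
    "('a::{t2_space,second_countable_topology}, 'e::euclidean_space) atlas \<Rightarrow> bool" where
  "smooth_manifold A \<longleftrightarrow>
     (\<Union>(U, \<phi>)\<in>A. U) = UNIV \<and>
     (\<forall>c\<in>A. chart c) \<and>
     (\<forall>(U, \<phi>)\<in>A. \<forall>(V, \<psi>)\<in>A. smooth_on (\<phi> ` (U \<inter> V)) (\<psi> \<circ> inv_into U \<phi>))"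

definition smooth_funs :: "('a, 'e::euclidean_space) atlas \<Rightarrow> ('a \<Rightarrow> real) set" where
  "smooth_funs A = {f. \<forall>(U, \<phi>)\<in>A. smooth_on (\<phi> ` U) (f \<circ> inv_into U \<phi>)}"

section \<open>Vector fields\<close>

type_synonym 'a tvec = "('a \<Rightarrow> real) \<Rightarrow> real"
type_synonym 'a vfield = "'a \<Rightarrow> 'a tvec"

(* Tangent vectors at p are the derivations at p of the algebra of smooth functions. The last
   clause makes equality of derivations coincide with equality of HOL functions. *)
definition tangent_space :: "('a, 'e::euclidean_space) atlas \<Rightarrow> 'a \<Rightarrow> 'a tvec set" where
  "tangent_space A p = {v.
     (\<forall>f\<in>smooth_funs A. \<forall>h\<in>smooth_funs A. v (f + h) = v f + v h) \<and>
     (\<forall>c. \<forall>f\<in>smooth_funs A. v (\<lambda>q. c * f q) = c * v f) \<and>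
     (\<forall>f\<in>smooth_funs A. \<forall>h\<in>smooth_funs A. v (f * h) = f p * v h + h p * v f) \<and>
     (\<forall>f. f \<notin> smooth_funs A \<longrightarrow> v f = 0)}"

definition vector_fields :: "('a, 'e::euclidean_space) atlas \<Rightarrow> 'a vfield set" where
  "vector_fields A = {X. (\<forall>p. X p \<in> tangent_space A p) \<and>
     (\<forall>f\<in>smooth_funs A. (\<lambda>p. X p f) \<in> smooth_funs A)}"

(* Sums, differences, negatives and zero of vector fields are the pointwise ones of
   HOL-Library.Function_Algebras. *)
definition vscale :: "('a \<Rightarrow> real) \<Rightarrow> 'a vfield \<Rightarrow> 'a vfield" where
  "vscale h X = (\<lambda>p f. h p * X p f)"

definition lie_bracket :: "'a vfield \<Rightarrow> 'a vfield \<Rightarrow> 'a vfield" where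
  "lie_bracket X Y = (\<lambda>p f. X p (\<lambda>q. Y q f) - Y p (\<lambda>q. X q f))"

section \<open>Tensor fields\<close>

(* Tensor fields are maps on vector fields that are multilinear over the smooth functions.
   The maps are HOL functions on all of 'a vfield, but only their values on vector_fields A
   matter. *)

type_synonym 'a metric = "'a vfield \<Rightarrow> 'a vfield \<Rightarrow> 'a \<Rightarrow> real"
type_synonym 'a endo = "'a vfield \<Rightarrow> 'a vfield"
type_synonym 'a conn = "'a vfield \<Rightarrow> 'a vfield \<Rightarrow> 'a vfield"
type_synonym 'a tens13 = "'a vfield \<Rightarrow> 'a vfield \<Rightarrow> 'a vfield \<Rightarrow> 'a vfield"

definition linear_to_vf :: "('a, 'e::euclidean_space) atlas \<Rightarrow> ('a vfield \<Rightarrow> 'a vfield) \<Rightarrow> bool" where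
  "linear_to_vf A T \<longleftrightarrow>
     (\<forall>X\<in>vector_fields A. T X \<in> vector_fields A) \<and>
     (\<forall>X\<in>vector_fields A. \<forall>Y\<in>vector_fields A. T (X + Y) = T X + T Y) \<and>
     (\<forall>h\<in>smooth_funs A. \<forall>X\<in>vector_fields A. T (vscale h X) = vscale h (T X))"

definition linear_to_fun :: "('a, 'e::euclidean_space) atlas \<Rightarrow> ('a vfield \<Rightarrow> 'a \<Rightarrow> real) \<Rightarrow> bool" where
  "linear_to_fun A T \<longleftrightarrow>
     (\<forall>X\<in>vector_fields A. T X \<in> smooth_funs A) \<and>
     (\<forall>X\<in>vector_fields A. \<forall>Y\<in>vector_fields A. T (X + Y) = T X + T Y) \<and>
     (\<forall>h\<in>smooth_funs A. \<forall>X\<in>vector_fields A. T (vscale h X) = h * T X)"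

definition tensor_1_1 :: "('a, 'e::euclidean_space) atlas \<Rightarrow> 'a endo \<Rightarrow> bool" where
  "tensor_1_1 A J \<longleftrightarrow> linear_to_vf A J"

definition tensor_0_2 :: "('a, 'e::euclidean_space) atlas \<Rightarrow> 'a metric \<Rightarrow> bool" where
  "tensor_0_2 A g \<longleftrightarrow> (\<forall>X\<in>vector_fields A. \<forall>Y\<in>vector_fields A.
     linear_to_fun A (\<lambda>Z. g Z Y) \<and> linear_to_fun A (\<lambda>Z. g X Z))"

definition tensor_1_3 :: "('a, 'e::euclidean_space) atlas \<Rightarrow> 'a tens13 \<Rightarrow> bool" where
  "tensor_1_3 A T \<longleftrightarrow>
     (\<forall>X\<in>vector_fields A. \<forall>Y\<in>vector_fields A. \<forall>Z\<in>vector_fields A.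
        linear_to_vf A (\<lambda>W. T W Y Z) \<and> linear_to_vf A (\<lambda>W. T X W Z) \<and> linear_to_vf A (\<lambda>W. T X Y W))"

definition tensor_1_3_eq :: "('a, 'e::euclidean_space) atlas \<Rightarrow> 'a tens13 \<Rightarrow> 'a tens13 \<Rightarrow> bool" where
  "tensor_1_3_eq A S T \<longleftrightarrow>
     (\<forall>X\<in>vector_fields A. \<forall>Y\<in>vector_fields A. \<forall>Z\<in>vector_fields A. S X Y Z = T X Y Z)"

section \<open>Almost complex manifolds with Norden metric\<close>

(* The last clause is nondegeneracy of g at each point p: as every tangent vector at p is the
   value X p of some vector field X, it says that the zero vector is the only tangent vector
   orthogonal to the whole tangent space at p. No condition is put on the signature; for a
   Norden metric it is automatically neutral. *)
definition pseudo_riemannian :: "('a, 'e::euclidean_space) atlas \<Rightarrow> 'a metric \<Rightarrow> bool" where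
  "pseudo_riemannian A g \<longleftrightarrow> tensor_0_2 A g \<and>
     (\<forall>X\<in>vector_fields A. \<forall>Y\<in>vector_fields A. g X Y = g Y X) \<and>
     (\<forall>p. \<forall>X\<in>vector_fields A. (\<forall>Y\<in>vector_fields A. g X Y p = 0) \<longrightarrow> X p = 0)"

definition almost_complex :: "('a, 'e::euclidean_space) atlas \<Rightarrow> 'a endo \<Rightarrow> bool" where
  "almost_complex A J \<longleftrightarrow> tensor_1_1 A J \<and> (\<forall>X\<in>vector_fields A. J (J X) = - X)"

definition norden_manifold ::
    "('a::{t2_space,second_countable_topology}, 'e::euclidean_space) atlas \<Rightarrow> 'a endo \<Rightarrow> 'a metric \<Rightarrow> bool" where
  "norden_manifold A J g \<longleftrightarrow> smooth_manifold A \<and> almost_complex A J \<and> pseudo_riemannian A g \<and>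
     (\<forall>X\<in>vector_fields A. \<forall>Y\<in>vector_fields A. g (J X) (J Y) = - g X Y)"

definition associated_metric :: "'a endo \<Rightarrow> 'a metric \<Rightarrow> 'a metric" where
  "associated_metric J g = (\<lambda>X Y. g (J X) Y)"

section \<open>Connections and curvature\<close>

definition connection :: "('a, 'e::euclidean_space) atlas \<Rightarrow> 'a conn \<Rightarrow> bool" where
  "connection A D \<longleftrightarrow>
     (\<forall>Y\<in>vector_fields A. linear_to_vf A (\<lambda>X. D X Y)) \<and>
     (\<forall>X\<in>vector_fields A. \<forall>Y\<in>vector_fields A. \<forall>Z\<in>vector_fields A. D X (Y + Z) = D X Y + D X Z) \<and>
     (\<forall>h\<in>smooth_funs A. \<forall>X\<in>vector_fields A. \<forall>Y\<in>vector_fields A.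
        D X (vscale h Y) = vscale (\<lambda>p. X p h) Y + vscale h (D X Y))"

definition torsion_free :: "('a, 'e::euclidean_space) atlas \<Rightarrow> 'a conn \<Rightarrow> bool" where
  "torsion_free A D \<longleftrightarrow>
     (\<forall>X\<in>vector_fields A. \<forall>Y\<in>vector_fields A. D X Y - D Y X = lie_bracket X Y)"

definition metric_connection :: "('a, 'e::euclidean_space) atlas \<Rightarrow> 'a metric \<Rightarrow> 'a conn \<Rightarrow> bool" where
  "metric_connection A g D \<longleftrightarrow>
     (\<forall>X\<in>vector_fields A. \<forall>Y\<in>vector_fields A. \<forall>Z\<in>vector_fields A.
        (\<lambda>p. X p (g Y Z)) = g (D X Y) Z + g Y (D X Z))"

definition levi_civita :: "('a, 'e::euclidean_space) atlas \<Rightarrow> 'a metric \<Rightarrow> 'a conn \<Rightarrow> bool" where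
  "levi_civita A g D \<longleftrightarrow> connection A D \<and> torsion_free A D \<and> metric_connection A g D"

definition curvature :: "'a conn \<Rightarrow> 'a tens13" where
  "curvature D X Y Z = D X (D Y Z) - D Y (D X Z) - D (lie_bracket X Y) Z"

definition average_connection :: "'a conn \<Rightarrow> 'a conn \<Rightarrow> 'a conn" where
  "average_connection D Dt X Y = vscale (\<lambda>_. 1/2) (D X Y + Dt X Y)"

definition average_tensor :: "'a conn \<Rightarrow> 'a conn \<Rightarrow> 'a tens13" where
  "average_tensor D Dt X Y Z = vscale (\<lambda>_. 1/2) (curvature D X Y Z + curvature Dt X Y Z)"

definition average_combination :: "real \<Rightarrow> real \<Rightarrow> 'a conn \<Rightarrow> 'a conn \<Rightarrow> 'a tens13" where
  "average_combination a b D Dt X Y Z =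
     vscale (\<lambda>_. a) (average_tensor D Dt X Y Z) +
     vscale (\<lambda>_. b) (curvature (average_connection D Dt) X Y Z)"

section \<open>Twin interchange\<close>

(* (D, Dt) are the Levi-Civita connections of g and of its associated metric. *)
definition twin_connections ::
    "('a, 'e::euclidean_space) atlas \<Rightarrow> 'a endo \<Rightarrow> 'a metric \<Rightarrow> 'a conn \<Rightarrow> 'a conn \<Rightarrow> bool" where
  "twin_connections A J g D Dt \<longleftrightarrow> levi_civita A g D \<and> levi_civita A (associated_metric J g) Dt"

(* F constructs a tensor from the Levi-Civita connections belonging to (M,J,g). Invariance
   compares F for (M,J,g) with F for (M,J,g~), where g~ is the associated metric of g; the
   second Levi-Civita connection of (M,J,g~) is that of the associated metric of g~. *)
definition twin_invariant ::
    "('a, 'e::euclidean_space) atlas \<Rightarrow> 'a endo \<Rightarrow> 'a metric \<Rightarrow> ('a conn \<Rightarrow> 'a conn \<Rightarrow> 'a tens13) \<Rightarrow> bool" where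
  "twin_invariant A J g F \<longleftrightarrow>
     (\<forall>D Dt D' Dt'. twin_connections A J g D Dt \<longrightarrow>
        twin_connections A J (associated_metric J g) D' Dt' \<longrightarrow>
        tensor_1_3_eq A (F D Dt) (F D' Dt'))"

end

theory Submission
  imports Defs
begin

text \<open>
  Two independent facts are at work.

  Tensoriality: the curvature of any connection is \<open>C\<^sup>\<infinity>\<close>-multilinear, because the derivative
  terms produced by the Leibniz rule in \<open>D\<^sub>X D\<^sub>Y - D\<^sub>Y D\<^sub>X\<close> are exactly those that the bracket
  produces in \<open>D\<^bsub>[X,Y]\<^esub>\<close> (\<open>tensor_curvature\<close>). The mean of two connections is again a connection
  (\<open>connection_average\<close>): the weights sum to one, so the derivative term of the Leibniz rule
  survives with coefficient one. Hence both \<open>B\<close> and the curvature of \<open>D\<^sup>\<diamond>\<close> are tensors, and so are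
  their linear combinations. All this rests on vector fields being closed under the bracket, and
  therefore on smooth functions being an algebra.

  Invariance: the twin interchange only swaps the two connections. Passing to the associated metric
  twice turns \<open>g\<close> into \<open>-g\<close>, and a connection is the Levi-Civita connection of \<open>-g\<close> iff it is that
  of \<open>g\<close>. By uniqueness (\<open>levi_civita_unique\<close>, applied to \<open>g\<close> and to its associated metric), the pair
  of connections belonging to \<open>(M,J,g~)\<close> is \<open>(D~, D)\<close>. Both averages are symmetric in
  \<open>D\<close> and \<open>D~\<close>, so nothing changes.
\<close>

section \<open>Differentiable functions form an algebra\<close>

text \<open>Openness of \<open>S\<close> makes the Frechet derivative at a point of \<open>S\<close> depend only on the values
  on \<open>S\<close>. This licenses replacing the derivative of a sum or a product by the formula that the
  calculus rules give on \<open>S\<close>.\<close>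

lemma Ck_on_cong:
  assumes "open S" "\<And>x. x \<in> S \<Longrightarrow> f x = h x"
  shows "Ck_on k S f \<longleftrightarrow> Ck_on k S h"
  using assms(2)
proof (induction k arbitrary: f h)
  case 0
  then show ?case by (auto intro: continuous_on_cong)
next
  case (Suc k)
  have hd: "(f has_derivative F) (at x) \<longleftrightarrow> (h has_derivative F) (at x)" if "x \<in> S" for x F
    using has_derivative_transform_within_open[OF _ assms(1) that] Suc.prems by metis
  have "frechet_derivative f (at x) = frechet_derivative h (at x)" if "x \<in> S" for x
    unfolding frechet_derivative_def using hd[OF that] by simp
  then have "Ck_on k S (\<lambda>x. frechet_derivative f (at x) v) \<longleftrightarrow>
      Ck_on k S (\<lambda>x. frechet_derivative h (at x) v)" for v
    by (intro Suc.IH) simp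
  moreover have "f differentiable (at x) \<longleftrightarrow> h differentiable (at x)" if "x \<in> S" for x
    unfolding differentiable_def using hd[OF that] by simp
  ultimately show ?case by simp
qed

lemma Ck_on_Suc_imp: "Ck_on (Suc k) S f \<Longrightarrow> Ck_on k S f"
proof (induction k arbitrary: f)
  case 0
  then show ?case
    by (simp add: differentiable_at_imp_differentiable_on differentiable_imp_continuous_on)
next
  case (Suc k)
  then show ?case by (metis Ck_on.simps(2))
qed

lemma Ck_on_const: "Ck_on k S (\<lambda>_. c)"
  by (induction k arbitrary: c) auto

lemma Ck_on_add:
  assumes "open S"
  shows "Ck_on k S f \<Longrightarrow> Ck_on k S h \<Longrightarrow> Ck_on k S (\<lambda>x. f x + h x)"
proof (induction k arbitrary: f h)
  case 0
  then show ?case by (auto intro: continuous_on_add)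
next
  case (Suc k)
  have "frechet_derivative (\<lambda>x. f x + h x) (at x) v =
      frechet_derivative f (at x) v + frechet_derivative h (at x) v" if "x \<in> S" for x v
  proof -
    have "((\<lambda>x. f x + h x) has_derivative
        (\<lambda>v. frechet_derivative f (at x) v + frechet_derivative h (at x) v)) (at x)"
      using Suc.prems that
      by (intro has_derivative_add frechet_derivative_works[THEN iffD1]) simp_all
    from frechet_derivative_at[OF this, symmetric] show ?thesis by simp
  qed
  then have "Ck_on k S (\<lambda>x. frechet_derivative (\<lambda>x. f x + h x) (at x) v) \<longleftrightarrow>
      Ck_on k S (\<lambda>x. frechet_derivative f (at x) v + frechet_derivative h (at x) v)" for v
    by (intro Ck_on_cong assms) auto
  then show ?case using Suc by auto
qed

text \<open>The product rule expresses the derivative through \<open>f\<close> and \<open>h\<close> themselves besides their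
  derivatives, so the induction needs that they are also of the lower class \<open>C\<^sup>k\<close>.\<close>

lemma Ck_on_mult:
  fixes f h :: "'e::euclidean_space \<Rightarrow> 'b::real_normed_algebra"
  assumes "open S"
  shows "Ck_on k S f \<Longrightarrow> Ck_on k S h \<Longrightarrow> Ck_on k S (\<lambda>x. f x * h x)"
proof (induction k arbitrary: f h)
  case 0
  then show ?case by (auto intro: continuous_on_mult)
next
  case (Suc k)
  have "frechet_derivative (\<lambda>x. f x * h x) (at x) v =
      f x * frechet_derivative h (at x) v + frechet_derivative f (at x) v * h x"
    if "x \<in> S" for x v
  proof -
    have "((\<lambda>x. f x * h x) has_derivative
        (\<lambda>v. f x * frechet_derivative h (at x) v + frechet_derivative f (at x) v * h x)) (at x)"
      using Suc.prems that
      by (intro has_derivative_mult frechet_derivative_works[THEN iffD1]) simp_all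
    from frechet_derivative_at[OF this, symmetric] show ?thesis by simp
  qed
  then have "Ck_on k S (\<lambda>x. frechet_derivative (\<lambda>x. f x * h x) (at x) v) \<longleftrightarrow>
      Ck_on k S (\<lambda>x. f x * frechet_derivative h (at x) v + frechet_derivative f (at x) v * h x)" for v
    by (intro Ck_on_cong assms) auto
  moreover have "Ck_on k S (\<lambda>x. f x * frechet_derivative h (at x) v
      + frechet_derivative f (at x) v * h x)" for v
    using Suc.prems Ck_on_Suc_imp[OF Suc.prems(1)] Ck_on_Suc_imp[OF Suc.prems(2)]
    by (intro Ck_on_add[OF assms] Suc.IH) auto
  ultimately show ?case using Suc.prems by (auto intro: differentiable_mult)
qed

locale manifold =
  fixes A :: "('a::{t2_space,second_countable_topology}, 'e::euclidean_space) atlas"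
  assumes smooth_mfd: "smooth_manifold A"
begin

abbreviation "SF \<equiv> smooth_funs A"
abbreviation "VF \<equiv> vector_fields A"

lemma open_chart_image: "(U, \<phi>) \<in> A \<Longrightarrow> open (\<phi> ` U)"
  using smooth_mfd unfolding smooth_manifold_def chart_def by blast

lemma smooth_const: "(\<lambda>_. c) \<in> SF"
  unfolding smooth_funs_def smooth_on_def by (auto simp: o_def Ck_on_const)

lemma smooth_add:
  assumes "f \<in> SF" "h \<in> SF"
  shows "f + h \<in> SF" "(\<lambda>p. f p + h p) \<in> SF"
proof -
  show "(\<lambda>p. f p + h p) \<in> SF"
    using assms Ck_on_add[OF open_chart_image] unfolding smooth_funs_def smooth_on_def o_def
    by blast
  then show "f + h \<in> SF" by (simp add: plus_fun_def)
qed

lemma smooth_mult: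
  assumes "f \<in> SF" "h \<in> SF"
  shows "f * h \<in> SF" "(\<lambda>p. f p * h p) \<in> SF"
proof -
  show "(\<lambda>p. f p * h p) \<in> SF"
    using assms Ck_on_mult[OF open_chart_image] unfolding smooth_funs_def smooth_on_def o_def
    by blast
  then show "f * h \<in> SF" by (simp add: times_fun_def)
qed

lemma smooth_diff:
  assumes "f \<in> SF" "h \<in> SF"
  shows "(\<lambda>p. f p - h p) \<in> SF"
  using smooth_add(2)[OF assms(1) smooth_mult(2)[OF smooth_const[of "-1"] assms(2)]] by simp

section \<open>The Lie algebra of vector fields\<close>

lemma vf_smooth: "X \<in> VF \<Longrightarrow> f \<in> SF \<Longrightarrow> (\<lambda>p. X p f) \<in> SF"
  unfolding vector_fields_def by auto

lemma vf_add: "X \<in> VF \<Longrightarrow> f \<in> SF \<Longrightarrow> h \<in> SF \<Longrightarrow> X p (\<lambda>q. f q + h q) = X p f + X p h"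
  unfolding vector_fields_def tangent_space_def by (auto simp: plus_fun_def)

lemma vf_mult:
  "X \<in> VF \<Longrightarrow> f \<in> SF \<Longrightarrow> h \<in> SF \<Longrightarrow> X p (\<lambda>q. f q * h q) = f p * X p h + h p * X p f"
  unfolding vector_fields_def tangent_space_def by (auto simp: times_fun_def)

lemma vf_scale: "X \<in> VF \<Longrightarrow> f \<in> SF \<Longrightarrow> X p (\<lambda>q. c * f q) = c * X p f"
  unfolding vector_fields_def tangent_space_def by auto

lemma vf_minus: "X \<in> VF \<Longrightarrow> f \<in> SF \<Longrightarrow> X p (\<lambda>q. - f q) = - X p f"
  using vf_scale[of X f p "-1"] by simp

text \<open>The Leibniz rule for \<open>1 = 1 * 1\<close> gives \<open>X 1 = 2 * X 1\<close>.\<close>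

lemma vf_const: "X \<in> VF \<Longrightarrow> X p (\<lambda>q. c) = 0"
  using vf_mult[of X "\<lambda>_. 1" "\<lambda>_. 1" p] vf_scale[of X "\<lambda>_. 1" p c] smooth_const by auto

lemma vf_nonsmooth: "X \<in> VF \<Longrightarrow> f \<notin> SF \<Longrightarrow> X p f = 0"
  unfolding vector_fields_def tangent_space_def by auto

lemma vfI:
  assumes "\<And>f. f \<in> SF \<Longrightarrow> (\<lambda>p. X p f) \<in> SF"
    and "\<And>p f h. f \<in> SF \<Longrightarrow> h \<in> SF \<Longrightarrow> X p (\<lambda>q. f q + h q) = X p f + X p h"
    and "\<And>p f c. f \<in> SF \<Longrightarrow> X p (\<lambda>q. c * f q) = c * X p f"
    and "\<And>p f h. f \<in> SF \<Longrightarrow> h \<in> SF \<Longrightarrow> X p (\<lambda>q. f q * h q) = f p * X p h + h p * X p f"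
    and "\<And>p f. f \<notin> SF \<Longrightarrow> X p f = 0"
  shows "X \<in> VF"
  unfolding vector_fields_def tangent_space_def
  using assms by (auto simp: plus_fun_def times_fun_def)

lemma vf_add_closed: "X \<in> VF \<Longrightarrow> Y \<in> VF \<Longrightarrow> X + Y \<in> VF"
  by (rule vfI)
    (simp_all add: vf_smooth smooth_add vf_add vf_scale vf_mult vf_nonsmooth algebra_simps)

lemma vf_vscale_closed: "h \<in> SF \<Longrightarrow> X \<in> VF \<Longrightarrow> vscale h X \<in> VF"
  by (rule vfI) (simp_all add: vscale_def vf_smooth smooth_mult vf_add vf_scale vf_mult
      vf_nonsmooth algebra_simps)

lemma minus_eq_vscale: "- X = vscale (\<lambda>_. -1) X"
  by (simp add: vscale_def fun_eq_iff)

lemma vf_minus_closed: "X \<in> VF \<Longrightarrow> - X \<in> VF"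
  unfolding minus_eq_vscale by (intro vf_vscale_closed smooth_const)

lemma vf_diff_closed: "X \<in> VF \<Longrightarrow> Y \<in> VF \<Longrightarrow> X - Y \<in> VF"
  using vf_add_closed[OF _ vf_minus_closed, of X Y] by simp

text \<open>The composite of two derivations violates the Leibniz rule by the cross terms
  \<open>(X f) (Y h) + (Y f) (X h)\<close>; being symmetric in \<open>X\<close> and \<open>Y\<close>, they cancel in the commutator. On
  functions that are not smooth both composites vanish, the inner one being the zero function.\<close>

lemma vf_bracket_closed:
  assumes "X \<in> VF" "Y \<in> VF"
  shows "lie_bracket X Y \<in> VF"
proof -
  (* With a schematic field in head position these rules would not be higher-order patterns
     and could not match arguments such as \<open>\<lambda>q. Y q f + Y q h\<close>. *)
  note derivation = vf_smooth vf_add[of X] vf_add[of Y] vf_mult[of X] vf_mult[of Y]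
    vf_scale[of X] vf_scale[of Y] vf_const
  show ?thesis
  proof (rule vfI)
    fix p f h assume "f \<in> SF" "h \<in> SF"
    with assms show "lie_bracket X Y p (\<lambda>q. f q * h q)
        = f p * lie_bracket X Y p h + h p * lie_bracket X Y p f"
      by (simp add: lie_bracket_def derivation smooth_mult algebra_simps)
  qed (use assms in \<open>simp_all add: lie_bracket_def derivation smooth_diff vf_nonsmooth
      algebra_simps\<close>)
qed

lemmas vf_closed = vf_add_closed vf_vscale_closed vf_minus_closed vf_diff_closed vf_bracket_closed

lemma lie_bracket_add:
  assumes "X \<in> VF" "W \<in> VF" "Y \<in> VF"
  shows "lie_bracket (X + W) Y = lie_bracket X Y + lie_bracket W Y"
proof (intro ext)
  fix p f show "lie_bracket (X + W) Y p f = (lie_bracket X Y + lie_bracket W Y) p f"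
    using assms vf_nonsmooth[OF assms(1), of f] vf_nonsmooth[OF assms(2), of f]
    by (cases "f \<in> SF") (simp_all add: lie_bracket_def vf_smooth vf_add[of Y] vf_const)
qed

lemma lie_bracket_vscale:
  assumes "h \<in> SF" "X \<in> VF" "Y \<in> VF"
  shows "lie_bracket (vscale h X) Y = vscale h (lie_bracket X Y) - vscale (\<lambda>p. Y p h) X"
proof (intro ext)
  fix p f show "lie_bracket (vscale h X) Y p f
      = (vscale h (lie_bracket X Y) - vscale (\<lambda>p. Y p h) X) p f"
    using assms vf_nonsmooth[OF assms(2), of f]
    by (cases "f \<in> SF")
      (simp_all add: lie_bracket_def vscale_def vf_smooth vf_mult[of Y] vf_const algebra_simps)
qed

end

lemma lie_bracket_swap: "lie_bracket X Y = - lie_bracket Y X"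
  by (simp add: lie_bracket_def fun_eq_iff)

section \<open>Curvature is a tensor\<close>

lemma vscale_plus: "vscale h (X + Y) = vscale h X + vscale h Y"
  by (simp add: vscale_def fun_eq_iff algebra_simps)

lemma vscale_vscale_commute: "vscale h (vscale k X) = vscale k (vscale h X)"
  by (simp add: vscale_def fun_eq_iff)

context manifold
begin

lemma tensor_1_3_add:
  assumes "tensor_1_3 A S" "tensor_1_3 A T"
  shows "tensor_1_3 A (\<lambda>X Y Z. S X Y Z + T X Y Z)"
  using assms unfolding tensor_1_3_def linear_to_vf_def
  by (simp add: vf_closed vscale_plus add_ac)

lemma tensor_1_3_scale:
  assumes "k \<in> SF" "tensor_1_3 A T"
  shows "tensor_1_3 A (\<lambda>X Y Z. vscale k (T X Y Z))"
  using assms unfolding tensor_1_3_def linear_to_vf_def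
  by (simp add: vf_closed vscale_plus vscale_vscale_commute[of k])

end

locale affine_connection = manifold A
  for A :: "('a::{t2_space,second_countable_topology}, 'e::euclidean_space) atlas" +
  fixes D :: "'a conn"
  assumes conn: "connection A D"
begin

lemma D_closed: "X \<in> VF \<Longrightarrow> Y \<in> VF \<Longrightarrow> D X Y \<in> VF"
  using conn unfolding connection_def linear_to_vf_def by blast

lemma D_add_left: "X \<in> VF \<Longrightarrow> W \<in> VF \<Longrightarrow> Y \<in> VF \<Longrightarrow> D (X + W) Y = D X Y + D W Y"
  using conn unfolding connection_def linear_to_vf_def by blast

lemma D_vscale_left: "h \<in> SF \<Longrightarrow> X \<in> VF \<Longrightarrow> Y \<in> VF \<Longrightarrow> D (vscale h X) Y = vscale h (D X Y)"
  using conn unfolding connection_def linear_to_vf_def by blast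

lemma D_minus_left: "X \<in> VF \<Longrightarrow> Y \<in> VF \<Longrightarrow> D (- X) Y = - D X Y"
  unfolding minus_eq_vscale by (intro D_vscale_left smooth_const)

lemma D_diff_left: "X \<in> VF \<Longrightarrow> W \<in> VF \<Longrightarrow> Y \<in> VF \<Longrightarrow> D (X - W) Y = D X Y - D W Y"
  using D_add_left[of X "- W" Y] by (simp add: D_minus_left vf_closed)

lemma D_add_right: "X \<in> VF \<Longrightarrow> Y \<in> VF \<Longrightarrow> Z \<in> VF \<Longrightarrow> D X (Y + Z) = D X Y + D X Z"
  using conn unfolding connection_def by blast

lemma D_vscale_right: "h \<in> SF \<Longrightarrow> X \<in> VF \<Longrightarrow> Y \<in> VF \<Longrightarrow>
    D X (vscale h Y) = vscale (\<lambda>p. X p h) Y + vscale h (D X Y)"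
  using conn unfolding connection_def by blast

lemmas D_rules = D_closed D_add_left D_vscale_left D_minus_left D_diff_left D_add_right
  D_vscale_right vf_closed vf_smooth

lemma curvature_closed: "X \<in> VF \<Longrightarrow> Y \<in> VF \<Longrightarrow> Z \<in> VF \<Longrightarrow> curvature D X Y Z \<in> VF"
  by (simp add: curvature_def D_rules)

lemma curvature_add_1: "X \<in> VF \<Longrightarrow> W \<in> VF \<Longrightarrow> Y \<in> VF \<Longrightarrow> Z \<in> VF \<Longrightarrow>
    curvature D (X + W) Y Z = curvature D X Y Z + curvature D W Y Z"
  by (simp add: curvature_def lie_bracket_add D_rules)

text \<open>\<open>- D\<^sub>Y D\<^bsub>hX\<^esub> Z\<close> contributes \<open>- (Y h) D\<^sub>X Z\<close>, which is cancelled by the contribution of the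
  term \<open>- (Y h) X\<close> of \<open>[hX, Y]\<close> to \<open>- D\<^bsub>[hX,Y]\<^esub> Z\<close>.\<close>

lemma curvature_vscale_1: "h \<in> SF \<Longrightarrow> X \<in> VF \<Longrightarrow> Y \<in> VF \<Longrightarrow> Z \<in> VF \<Longrightarrow>
    curvature D (vscale h X) Y Z = vscale h (curvature D X Y Z)"
  by (simp add: curvature_def lie_bracket_vscale D_rules)
    (simp add: fun_eq_iff vscale_def algebra_simps)

lemma curvature_swap: "X \<in> VF \<Longrightarrow> Y \<in> VF \<Longrightarrow> Z \<in> VF \<Longrightarrow>
    curvature D X Y Z = - curvature D Y X Z"
  unfolding curvature_def by (subst lie_bracket_swap[of X Y]) (simp add: D_rules)

lemma curvature_add_3: "X \<in> VF \<Longrightarrow> Y \<in> VF \<Longrightarrow> Z \<in> VF \<Longrightarrow> W \<in> VF \<Longrightarrow>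
    curvature D X Y (Z + W) = curvature D X Y Z + curvature D X Y W"
  by (simp add: curvature_def D_rules)

text \<open>The terms with one derivative of \<open>h\<close> are symmetric in \<open>X\<close> and \<open>Y\<close> and cancel. Those with two
  derivatives add up to \<open>(X (Y h) - Y (X h)) Z\<close>, which is the derivative term
  \<open>([X,Y] h) Z\<close> of \<open>D\<^bsub>[X,Y]\<^esub> (hZ)\<close>.\<close>

lemma curvature_vscale_3: "h \<in> SF \<Longrightarrow> X \<in> VF \<Longrightarrow> Y \<in> VF \<Longrightarrow> Z \<in> VF \<Longrightarrow>
    curvature D X Y (vscale h Z) = vscale h (curvature D X Y Z)"
  by (simp add: curvature_def D_rules)
    (simp add: fun_eq_iff vscale_def lie_bracket_def algebra_simps)

theorem tensor_curvature: "tensor_1_3 A (curvature D)"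
proof -
  have "curvature D X (Y + W) Z = curvature D X Y Z + curvature D X W Z"
    if "X \<in> VF" "Y \<in> VF" "W \<in> VF" "Z \<in> VF" for X Y W Z
    using that by (simp add: curvature_swap[of X] curvature_add_1 vf_closed)
  moreover have "curvature D X (vscale h Y) Z = vscale h (curvature D X Y Z)"
    if "h \<in> SF" "X \<in> VF" "Y \<in> VF" "Z \<in> VF" for h X Y Z
    using that by (simp add: curvature_swap[of X] curvature_vscale_1 vf_closed)
      (simp add: vscale_def fun_eq_iff)
  ultimately show ?thesis
    unfolding tensor_1_3_def linear_to_vf_def
    by (simp add: curvature_closed curvature_add_1 curvature_vscale_1
        curvature_add_3 curvature_vscale_3)
qed

end

text \<open>Connections form an affine space, not a vector space: the term \<open>(X h) Y\<close> of the Leibniz rule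
  has to keep the coefficient one, as \<open>1/2 + 1/2\<close> ensures.\<close>

lemma (in manifold) connection_average:
  assumes "connection A D" "connection A E"
  shows "connection A (average_connection D E)"
proof -
  interpret D: affine_connection A D by unfold_locales (rule assms)
  interpret E: affine_connection A E by unfold_locales (rule assms)
  show ?thesis
    unfolding connection_def linear_to_vf_def average_connection_def
    by (simp add: D.D_rules E.D_rules smooth_const)
      (simp add: vscale_def fun_eq_iff algebra_simps)
qed

lemma (in manifold) tensor_average_combination:
  assumes "connection A D" "connection A E"
  shows "tensor_1_3 A (average_combination a b D E)"
proof -
  have curv: "tensor_1_3 A (curvature F)" if "connection A F" for F
    by (rule affine_connection.tensor_curvature) (unfold_locales, rule that)
  have "tensor_1_3 A (average_tensor D E)"
    using tensor_1_3_scale[OF smooth_const tensor_1_3_add[OF curv curv], of D E "1/2"] assms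
    by (simp add: average_tensor_def[abs_def])
  then show ?thesis
    using tensor_1_3_add[OF tensor_1_3_scale[OF smooth_const] tensor_1_3_scale[OF smooth_const],
        of "average_tensor D E" "curvature (average_connection D E)" a b]
      curv[OF connection_average[OF assms]]
    by (simp add: average_combination_def[abs_def])
qed

section \<open>Uniqueness of the Levi-Civita connection\<close>

lemma (in manifold) metric_simps:
  assumes "tensor_0_2 A g" "X \<in> VF" "Y \<in> VF"
  shows "g X Y \<in> SF"
    and "W \<in> VF \<Longrightarrow> g (X - W) Y = g X Y - g W Y"
    and "W \<in> VF \<Longrightarrow> g X (Y - W) = g X Y - g X W"
    and "g (- X) Y = - g X Y"
    and "g X (- Y) = - g X Y"
proof -
  have lin: "linear_to_fun A (\<lambda>Z. g Z V)" "linear_to_fun A (\<lambda>Z. g V Z)" if "V \<in> VF" for V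
    using assms(1) that unfolding tensor_0_2_def by auto
  have neg: "T (- V) = - T V" if "linear_to_fun A T" "V \<in> VF" for T V
    using that smooth_const[of "-1"] unfolding minus_eq_vscale linear_to_fun_def
    by (simp add: fun_eq_iff)
  have diff: "T (V - W) = T V - T W" if "linear_to_fun A T" "V \<in> VF" "W \<in> VF" for T V W
  proof -
    have "T (V + - W) = T V + T (- W)"
      using that vf_minus_closed unfolding linear_to_fun_def by blast
    with neg[OF that(1,3)] show ?thesis by simp
  qed
  show "g X Y \<in> SF"
    using lin assms unfolding linear_to_fun_def by auto
  show "W \<in> VF \<Longrightarrow> g (X - W) Y = g X Y - g W Y" "g (- X) Y = - g X Y"
    using diff[OF lin(1)] neg[OF lin(1)] assms by auto
  show "W \<in> VF \<Longrightarrow> g X (Y - W) = g X Y - g X W" "g X (- Y) = - g X Y"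
    using diff[OF lin(2)] neg[OF lin(2)] assms by auto
qed

text \<open>The difference \<open>S = D - E\<close> of two such connections is symmetric, both being torsion-free, and
  \<open>g(S(X,Y),Z)\<close> is skew in \<open>Y\<close> and \<open>Z\<close>, both being metric. A trilinear form that is symmetric in the
  first two and skew in the last two arguments vanishes: alternating the two transpositions three
  times each leads back to the original order with the opposite sign. Nondegeneracy of \<open>g\<close> then
  yields \<open>S = 0\<close>.\<close>

lemma (in manifold) levi_civita_unique:
  assumes g: "pseudo_riemannian A g" and D: "levi_civita A g D" and E: "levi_civita A g E"
    and XY: "X \<in> VF" "Y \<in> VF"
  shows "D X Y = E X Y"
proof -
  interpret D: affine_connection A D using D by unfold_locales (simp add: levi_civita_def)
  interpret E: affine_connection A E using E by unfold_locales (simp add: levi_civita_def)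
  have g02: "tensor_0_2 A g" and gsym: "\<And>X Y. X \<in> VF \<Longrightarrow> Y \<in> VF \<Longrightarrow> g X Y = g Y X"
    using g unfolding pseudo_riemannian_def by auto
  define S where "S X Y = D X Y - E X Y" for X Y
  have S_closed: "S X Y \<in> VF" if "X \<in> VF" "Y \<in> VF" for X Y
    using that by (simp add: S_def D.D_closed E.D_closed vf_closed)
  have S_sym: "S X Y = S Y X" if "X \<in> VF" "Y \<in> VF" for X Y
  proof -
    have "D X Y - D Y X = E X Y - E Y X"
      using D E that unfolding levi_civita_def torsion_free_def by simp
    then show ?thesis unfolding S_def by (simp add: algebra_simps)
  qed
  define t where "t X Y Z = g (S X Y) Z" for X Y Z
  have t_sym: "t X Y Z = t Y X Z" if "X \<in> VF" "Y \<in> VF" for X Y Z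
    using S_sym[OF that] by (simp add: t_def)
  have t_skew: "t X Y Z = - t X Z Y" if "X \<in> VF" "Y \<in> VF" "Z \<in> VF" for X Y Z
  proof -
    have "g (D X Y) Z + g Y (D X Z) = g (E X Y) Z + g Y (E X Z)"
      using D E that unfolding levi_civita_def metric_connection_def by metis
    then have "g (S X Y) Z + g Y (S X Z) = 0"
      using that by (simp add: S_def metric_simps[OF g02] D.D_closed E.D_closed algebra_simps)
    then show ?thesis
      using gsym[of Y "S X Z"] that S_closed by (simp add: t_def eq_neg_iff_add_eq_0)
  qed
  have "g (S X Y) Z p = 0" if "Z \<in> VF" for Z p
  proof -
    have "t X Y Z = - t X Z Y" by (rule t_skew[OF XY that])
    also have "\<dots> = - t Z X Y" by (simp only: t_sym[OF XY(1) that])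
    also have "\<dots> = t Z Y X" by (simp only: t_skew[OF that XY] minus_minus)
    also have "\<dots> = t Y Z X" by (rule t_sym[OF that XY(2)])
    also have "\<dots> = - t Y X Z" by (rule t_skew[OF XY(2) that XY(1)])
    also have "\<dots> = - t X Y Z" by (simp only: t_sym[OF XY])
    finally have "t X Y Z p = (- t X Y Z) p" by (rule fun_cong)
    then show ?thesis by (simp add: t_def)
  qed
  then have "S X Y p = 0" for p
    using g S_closed[OF XY] unfolding pseudo_riemannian_def by blast
  then show ?thesis by (simp add: S_def fun_eq_iff)
qed

section \<open>The twin interchange\<close>

text \<open>The Norden condition makes \<open>J\<close> self-adjoint, whence the symmetry. For nondegeneracy,
  \<open>g(X,Y) = - g(JX,JY)\<close> shows that a vector orthogonal to everything for the associated metric is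
  so for \<open>g\<close>.\<close>

lemma (in manifold) pseudo_riemannian_associated:
  assumes "norden_manifold A J g"
  shows "pseudo_riemannian A (associated_metric J g)"
proof -
  have Jc: "\<And>X. X \<in> VF \<Longrightarrow> J X \<in> VF" and JJ: "\<And>X. X \<in> VF \<Longrightarrow> J (J X) = - X"
    and Jadd: "\<And>X Y. X \<in> VF \<Longrightarrow> Y \<in> VF \<Longrightarrow> J (X + Y) = J X + J Y"
    and Jsc: "\<And>h X. h \<in> SF \<Longrightarrow> X \<in> VF \<Longrightarrow> J (vscale h X) = vscale h (J X)"
    and g: "pseudo_riemannian A g"
    and gJJ: "\<And>X Y. X \<in> VF \<Longrightarrow> Y \<in> VF \<Longrightarrow> g (J X) (J Y) = - g X Y"
    using assms unfolding norden_manifold_def almost_complex_def tensor_1_1_def linear_to_vf_def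
    by auto
  have g02: "tensor_0_2 A g" and gsym: "\<And>X Y. X \<in> VF \<Longrightarrow> Y \<in> VF \<Longrightarrow> g X Y = g Y X"
    and nondeg: "\<And>p X. X \<in> VF \<Longrightarrow> (\<And>Y. Y \<in> VF \<Longrightarrow> g X Y p = 0) \<Longrightarrow> X p = 0"
    using g unfolding pseudo_riemannian_def by blast+
  have J_self_adjoint: "g (J X) Y = g X (J Y)" if "X \<in> VF" "Y \<in> VF" for X Y
    using gJJ[of "J X" Y] that by (simp add: JJ Jc metric_simps[OF g02])
  have "tensor_0_2 A (associated_metric J g)"
    using g02 unfolding tensor_0_2_def linear_to_fun_def associated_metric_def
    by (simp add: Jc Jadd Jsc vf_closed)
  moreover have "associated_metric J g X Y = associated_metric J g Y X"
    if "X \<in> VF" "Y \<in> VF" for X Y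
    using that by (simp add: associated_metric_def J_self_adjoint gsym[of X] Jc)
  moreover have "X p = 0"
    if "X \<in> VF" "\<forall>Y\<in>VF. associated_metric J g X Y p = 0" for p X
  proof (rule nondeg)
    fix Y assume Y: "Y \<in> VF"
    have "g X Y p = - g (J X) (J Y) p" using gJJ that Y by simp
    also have "\<dots> = 0" using that Jc[OF Y] by (simp add: associated_metric_def)
    finally show "g X Y p = 0" .
  qed (fact that(1))
  ultimately show ?thesis unfolding pseudo_riemannian_def by blast
qed

text \<open>Metric compatibility is linear in the metric, so it does not see a change of sign. The
  hypothesis relates \<open>m\<close> and \<open>g\<close> on vector fields alone because the identity \<open>J\<^sup>2 = -I\<close>, which makes
  the twice associated metric equal to \<open>- g\<close>, is available only there.\<close>

lemma (in manifold) levi_civita_neg: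
  assumes g: "tensor_0_2 A g" and m: "\<And>X Y. X \<in> VF \<Longrightarrow> Y \<in> VF \<Longrightarrow> m X Y = - g X Y"
    and D: "levi_civita A m D"
  shows "levi_civita A g D"
proof -
  interpret affine_connection A D using D by unfold_locales (simp add: levi_civita_def)
  have "X p (g Y Z) = (g (D X Y) Z + g Y (D X Z)) p" if "X \<in> VF" "Y \<in> VF" "Z \<in> VF" for X Y Z p
  proof -
    have "X p (m Y Z) = (m (D X Y) Z + m Y (D X Z)) p"
      using D that unfolding levi_civita_def metric_connection_def by metis
    moreover have "X p (m Y Z) = - X p (g Y Z)"
      using vf_minus[of X "g Y Z" p] that metric_simps(1)[OF g] by (simp add: m fun_Compl_def)
    ultimately show ?thesis using that by (simp add: m D_closed)
  qed
  then show ?thesis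
    using D unfolding levi_civita_def metric_connection_def by (simp add: fun_eq_iff)
qed

text \<open>Connections are compared on vector fields only; outside of them two Levi-Civita connections
  of the same metric may differ. Curvature applies \<open>D\<close> to values of \<open>D\<close> and to a bracket, which
  are vector fields again.\<close>

lemma (in manifold) curvature_cong:
  assumes "connection A D" "\<And>X Y. X \<in> VF \<Longrightarrow> Y \<in> VF \<Longrightarrow> D X Y = E X Y"
    and "X \<in> VF" "Y \<in> VF" "Z \<in> VF"
  shows "curvature D X Y Z = curvature E X Y Z"
proof -
  interpret affine_connection A D by unfold_locales (rule assms)
  have "D V W = E V W \<and> E V W \<in> VF" if "V \<in> VF" "W \<in> VF" for V W
    using that assms(2)[OF that] D_closed[OF that] by simp
  then show ?thesis using assms(3-) by (simp add: curvature_def vf_closed)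
qed

lemma average_combination_commute: "average_combination a b D E = average_combination a b E D"
proof -
  have "average_connection D E = average_connection E D"
    by (simp add: average_connection_def fun_eq_iff add.commute)
  moreover have "average_tensor D E = average_tensor E D"
    unfolding average_tensor_def[abs_def] by (simp add: add.commute)
  ultimately show ?thesis by (intro ext) (simp add: average_combination_def)
qed

lemma (in manifold) average_combination_cong:
  assumes "connection A D" "connection A E"
    and D: "\<And>X Y. X \<in> VF \<Longrightarrow> Y \<in> VF \<Longrightarrow> D X Y = D' X Y"
    and E: "\<And>X Y. X \<in> VF \<Longrightarrow> Y \<in> VF \<Longrightarrow> E X Y = E' X Y"
  shows "tensor_1_3_eq A (average_combination a b D E) (average_combination a b D' E')"
proof -
  have "average_connection D E X Y = average_connection D' E' X Y"
    if "X \<in> VF" "Y \<in> VF" for X Y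
    using that by (simp add: average_connection_def D E)
  then show ?thesis
    unfolding tensor_1_3_eq_def average_combination_def average_tensor_def
    using curvature_cong[OF assms(1) D] curvature_cong[OF assms(2) E]
      curvature_cong[OF connection_average[OF assms(1,2)]]
    by simp
qed

theorem theorem2p14:
  fixes A :: "('a::{t2_space,second_countable_topology}, 'e::euclidean_space) atlas"
    and J :: "'a endo" and g :: "'a metric" and D Dt :: "'a conn"
    and n :: nat and a b :: real
  assumes "DIM('e) = 2 * n"
    and "norden_manifold A J g"
    and "levi_civita A g D"
    and "levi_civita A (associated_metric J g) Dt"
  shows "tensor_1_3 A (average_combination a b D Dt) \<and>
         twin_invariant A J g (average_combination a b)"
proof
  interpret manifold A
    using assms(2) by unfold_locales (simp add: norden_manifold_def)
  show "tensor_1_3 A (average_combination a b D Dt)"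
    using assms(3,4) by (intro tensor_average_combination) (simp_all add: levi_civita_def)
  have g: "pseudo_riemannian A g" and g02: "tensor_0_2 A g"
    and J: "\<And>X. X \<in> VF \<Longrightarrow> J (J X) = - X"
    using assms(2) unfolding norden_manifold_def pseudo_riemannian_def almost_complex_def by auto
  show "twin_invariant A J g (average_combination a b)"
    unfolding twin_invariant_def
  proof (intro allI impI)
    fix D1 E1 D2 E2
    assume tw: "twin_connections A J g D1 E1"
      "twin_connections A J (associated_metric J g) D2 E2"
    have lc: "levi_civita A g D1" "levi_civita A (associated_metric J g) E1"
      "levi_civita A (associated_metric J g) D2"
      using tw unfolding twin_connections_def by auto
    have "associated_metric J (associated_metric J g) X Y = - g X Y"
      if "X \<in> VF" "Y \<in> VF" for X Y
      using that by (simp add: associated_metric_def J metric_simps[OF g02])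
    then have "levi_civita A g E2"
      using levi_civita_neg[OF g02] tw(2) unfolding twin_connections_def by blast
    then have "D1 X Y = E2 X Y" "E1 X Y = D2 X Y" if "X \<in> VF" "Y \<in> VF" for X Y
      using that levi_civita_unique[OF g lc(1)]
        levi_civita_unique[OF pseudo_riemannian_associated[OF assms(2)] lc(2,3)] by auto
    then have "tensor_1_3_eq A (average_combination a b D1 E1) (average_combination a b E2 D2)"
      using lc by (intro average_combination_cong) (simp_all add: levi_civita_def)
    then show "tensor_1_3_eq A (average_combination a b D1 E1) (average_combination a b D2 E2)"
      by (simp add: average_combination_commute[of a b E2])
  qed
qed

end
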